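(* Let $T>0$ and $K>0$. For every coefficient path $\mu\in\mathfrak m_T$ and every initial history $u_0\in C([-1,0])$, the initial-value problem $$z'(t)=\int_{[-1,0]}z(t+s)\,d\mu_t(s)\ \ (t\in[0,T]),\qquad z(t)=u_0(t)\ \ (t\in[-1,0]),$$ has a unique Carathéodory type solution, i.e. there is exactly one $z\in C([-1,T])$ with $z=u_0$ on $[-1,0]$ and $$z(t)=u_0(0)+\int_0^t\int_{[-1,0]}z(\tau+s)\,d\mu_\tau(s)\,d\tau\qquad\text{for all }t\in[0,T].$$
   Context: All functions are real-valued. Let $\mathfrak m$ be the set of all finite signed Borel measures $\nu$ on $[-1,0]$ with total variation norm $\|\nu\|_{\mathrm{TV}}\le K$. The coefficient space $\mathfrak m_T$ is the set of all maps $\mu:[0,T]\to\mathfrak m$, $t\mapsto\mu_t$, that are weak-* measurable: for every $f\in C([-1,0])$ the function $[0,T]\ni t\mapsto\int_{[-1,0]}f\,d\mu_t\in\mathbb R$ is Lebesgue measurable. For $\mu\in\mathfrak m_T$ and $z\in C([-1,T])$ the function $\tau\mapsto\int_{[-1,0]}z(\tau+s)\,d\mu_\tau(s)$ is in $L_\infty([0,T])$; the outer integral is a Lebesgue integral. *)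

theory Defs
  imports "HOL-Analysis.Analysis"
begin

text \<open>
  A finite signed measure on the measurable space of \<open>M\<close> is a real-valued set function; only its
  values on \<open>sets M\<close> matter, and the measure carried by \<open>M\<close> itself plays no role.
\<close>

definition signed_measure :: "'a measure \<Rightarrow> ('a set \<Rightarrow> real) \<Rightarrow> bool" where
  "signed_measure M \<nu> \<longleftrightarrow>
     \<nu> {} = 0 \<and>
     (\<forall>A :: nat \<Rightarrow> 'a set. range A \<subseteq> sets M \<longrightarrow> disjoint_family A \<longrightarrow>
        (\<lambda>i. \<nu> (A i)) sums \<nu> (\<Union>i. A i))"

definition tv_norm :: "'a measure \<Rightarrow> ('a set \<Rightarrow> real) \<Rightarrow> ennreal" where
  "tv_norm M \<nu> =
     (SUP P \<in> {P. finite P \<and> P \<subseteq> sets M \<and> partition_on (space M) P}. \<Sum>A\<in>P. ennreal \<bar>\<nu> A\<bar>)"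

text \<open>
  The positive and negative parts of the Jordan decomposition are the upper variations of \<open>\<nu>\<close> and
  of \<open>- \<nu>\<close>. Truncation of negative values by \<^const>\<open>ennreal\<close> is harmless, since \<open>B = {}\<close> is
  admitted in the supremum.
\<close>

definition pos_part_measure :: "'a measure \<Rightarrow> ('a set \<Rightarrow> real) \<Rightarrow> 'a measure" where
  "pos_part_measure M \<nu> =
     measure_of (space M) (sets M) (\<lambda>A. SUP B \<in> {B \<in> sets M. B \<subseteq> A}. ennreal (\<nu> B))"

definition neg_part_measure :: "'a measure \<Rightarrow> ('a set \<Rightarrow> real) \<Rightarrow> 'a measure" where
  "neg_part_measure M \<nu> = pos_part_measure M (\<lambda>A. - \<nu> A)"

definition signed_integral :: "'a measure \<Rightarrow> ('a set \<Rightarrow> real) \<Rightarrow> ('a \<Rightarrow> real) \<Rightarrow> real" where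
  "signed_integral M \<nu> f =
     (LINT x|pos_part_measure M \<nu>. f x) - (LINT x|neg_part_measure M \<nu>. f x)"

abbreviation delay_space :: "real measure" where
  "delay_space \<equiv> restrict_space borel {-1..0}"

definition bounded_signed_measures :: "real \<Rightarrow> (real set \<Rightarrow> real) set" where
  "bounded_signed_measures K =
     {\<nu>. signed_measure delay_space \<nu> \<and> tv_norm delay_space \<nu> \<le> ennreal K}"

text \<open>Coefficient paths are constrained on \<open>[0, T]\<close> only; their values elsewhere are never used.\<close>

definition coefficient_space :: "real \<Rightarrow> real \<Rightarrow> (real \<Rightarrow> real set \<Rightarrow> real) set" where
  "coefficient_space K T =
     {\<mu>. (\<forall>t\<in>{0..T}. \<mu> t \<in> bounded_signed_measures K) \<and>
         (\<forall>f. continuous_on {-1..0} f \<longrightarrow>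
            (\<lambda>t. signed_integral delay_space (\<mu> t) f) \<in> borel_measurable (lebesgue_on {0..T}))}"

text \<open>
  Elements of \<open>C([-1, T])\<close> are represented by functions that are \<^const>\<open>undefined\<close> outside
  \<open>[-1, T]\<close>, so that equality of functions is equality on \<open>[-1, T]\<close>. The integrability clause
  says that the outer Lebesgue integral exists, excluding the default value of the total
  integral operator.
\<close>

definition caratheodory_solution ::
    "real \<Rightarrow> (real \<Rightarrow> real set \<Rightarrow> real) \<Rightarrow> (real \<Rightarrow> real) \<Rightarrow> (real \<Rightarrow> real) \<Rightarrow> bool" where
  "caratheodory_solution T \<mu> u0 z \<longleftrightarrow>
     z \<in> extensional {-1..T} \<and> continuous_on {-1..T} z \<and>
     (\<forall>t\<in>{-1..0}. z t = u0 t) \<and>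
     set_integrable lebesgue {0..T} (\<lambda>\<tau>. signed_integral delay_space (\<mu> \<tau>) (\<lambda>s. z (\<tau> + s))) \<and>
     (\<forall>t\<in>{0..T}.
        z t = u0 0 + (LINT \<tau>:{0..t}|lebesgue. signed_integral delay_space (\<mu> \<tau>) (\<lambda>s. z (\<tau> + s))))"

end

theory Submission
  imports Defs
begin

text \<open>
  A solution is a fixed point of the Picard operator, which sends \<open>z\<close> to \<open>u0\<close> on the history
  interval and to \<open>u0 0\<close> plus the integral of the right-hand side afterwards. The proof makes this
  operator a contraction on a single complete space, so that Banach's theorem yields existence and
  uniqueness on all of \<open>[0, T]\<close> together, without gluing short intervals.

  The right-hand side is linear in \<open>z\<close>, and at time \<open>\<tau>\<close> it is at most \<open>2 * K\<close> times the supremum of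
  \<open>\<bar>z\<bar>\<close> on the delay window \<open>[\<tau> - 1, \<tau>]\<close>: each of the two parts of \<open>\<mu> \<tau>\<close> has mass at most \<open>K\<close>
  (lemma \<open>delayed_integral_bound\<close>). Measure the distance of two functions by the least \<open>D\<close> with
  \<open>\<bar>z t - w t\<bar> \<le> D * exp (4 * K * t)\<close>. The weight increases, so looking back in time costs nothing, and
  integrating \<open>2 * K * D * exp (4 * K * \<tau>)\<close> from 0 to \<open>t\<close> gives at most half of
  \<open>D * exp (4 * K * t)\<close>; thus the Picard operator halves the distance (lemma \<open>picard_diff_bound\<close>).

  For the operator to make sense, the right-hand side must be measurable in time. Weak-* measurability
  gives this only for a fixed test function, whereas here the test function \<open>s \<mapsto> z (\<tau> + s)\<close> moves with
  \<open>\<tau>\<close>. Freezing the translation at grid points of mesh \<open>1 / (n + 1)\<close> leaves countably many fixed test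
  functions, and the mesh tends to zero by continuity of \<open>z\<close> and dominated convergence
  (lemma \<open>borel_measurable_delayed_integral\<close>).
\<close>

section \<open>Integration against a signed measure of finite total variation\<close>

lemma space_pos_part [simp]: "space (pos_part_measure M \<nu>) = space M"
  by (simp add: pos_part_measure_def space_measure_of_conv)

lemma sets_pos_part [simp, measurable_cong]: "sets (pos_part_measure M \<nu>) = sets M"
  by (simp add: pos_part_measure_def sets.space_closed)

lemma signed_measure_uminus:
  assumes "signed_measure M \<nu>"
  shows "signed_measure M (\<lambda>A. - \<nu> A)"
  using assms unfolding signed_measure_def by (auto intro: sums_minus)

lemma tv_norm_uminus: "tv_norm M (\<lambda>A. - \<nu> A) = tv_norm M \<nu>"
  by (simp add: tv_norm_def)

text \<open>
  A measurable set \<open>B\<close> and its complement form a partition of the space, so \<open>\<nu> B\<close> is one of the terms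
  of a sum that the total variation dominates. Since \<^const>\<open>measure_of\<close> assigns to a set either the
  prescribed value or 0, the bound passes from the upper variation to the measure built from it.
\<close>

lemma emeasure_pos_part_le_tv_norm:
  assumes "signed_measure M \<nu>"
  shows "emeasure (pos_part_measure M \<nu>) (space M) \<le> tv_norm M \<nu>"
proof -
  have "ennreal (\<nu> B) \<le> tv_norm M \<nu>" if B: "B \<in> sets M" for B
  proof (cases "B = {}")
    case True
    then show ?thesis using assms by (simp add: signed_measure_def)
  next
    case False
    \<comment> \<open>The blocks of a partition are nonempty, so the complement is dropped when \<open>B\<close> is the whole space.\<close>
    define P where "P = {B, space M - B} - {{}}"
    have "B \<subseteq> space M" using B by (rule sets.sets_into_space)
    then have P: "finite P" "P \<subseteq> sets M" "partition_on (space M) P" "B \<in> P"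
      using B False by (auto simp: P_def partition_on_def disjoint_def)
    have "ennreal (\<nu> B) \<le> ennreal \<bar>\<nu> B\<bar>" by (simp add: ennreal_leI)
    also have "\<dots> \<le> (\<Sum>A\<in>P. ennreal \<bar>\<nu> A\<bar>)"
      using P by (intro member_le_sum) auto
    also have "\<dots> \<le> tv_norm M \<nu>"
      unfolding tv_norm_def using P by (intro SUP_upper) auto
    finally show ?thesis .
  qed
  then have "(SUP B \<in> {B \<in> sets M. B \<subseteq> space M}. ennreal (\<nu> B)) \<le> tv_norm M \<nu>"
    by (intro SUP_least) auto
  then show ?thesis
    by (simp add: pos_part_measure_def emeasure_measure_of_conv)
qed

lemma
  assumes \<nu>: "signed_measure M \<nu>" "tv_norm M \<nu> \<le> ennreal C" and "0 \<le> C"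
    and f: "f \<in> borel_measurable M" "\<And>x. x \<in> space M \<Longrightarrow> \<bar>f x\<bar> \<le> B" and "0 \<le> B"
  shows integrable_pos_part: "integrable (pos_part_measure M \<nu>) f"
    and integral_pos_part_le: "\<bar>LINT x|pos_part_measure M \<nu>. f x\<bar> \<le> C * B"
proof -
  let ?N = "pos_part_measure M \<nu>"
  have mass: "emeasure ?N (space ?N) \<le> ennreal C"
    using emeasure_pos_part_le_tv_norm[OF \<nu>(1)] \<nu>(2) by simp
  interpret N: finite_measure ?N
    using mass by (intro finite_measureI) (auto simp: top_unique)
  show int: "integrable ?N f"
    using f by (intro N.integrable_const_bound[of _ B]) auto
  have "\<bar>LINT x|?N. f x\<bar> \<le> (LINT x|?N. \<bar>f x\<bar>)"
    by (rule integral_abs_bound)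
  also have "\<dots> \<le> (LINT x|?N. B)"
    using f int by (intro integral_mono) auto
  also have "\<dots> = measure ?N (space ?N) * B" by simp
  also have "\<dots> \<le> C * B"
    using mass \<open>0 \<le> C\<close> \<open>0 \<le> B\<close> by (intro mult_right_mono) (auto simp: N.emeasure_eq_measure)
  finally show "\<bar>LINT x|?N. f x\<bar> \<le> C * B" .
qed

text \<open>
  Estimating the positive and the negative part separately loses a factor 2 against the sharp constant
  \<open>C\<close>. A larger constant only makes the weight in the contraction argument steeper.
\<close>

lemma signed_integral_bound:
  assumes "signed_measure M \<nu>" "tv_norm M \<nu> \<le> ennreal C" "0 \<le> C"
    and "f \<in> borel_measurable M" "\<And>x. x \<in> space M \<Longrightarrow> \<bar>f x\<bar> \<le> B" "0 \<le> B"
  shows "\<bar>signed_integral M \<nu> f\<bar> \<le> 2 * C * B"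
proof -
  have "\<bar>LINT x|pos_part_measure M \<nu>. f x\<bar> \<le> C * B"
    by (rule integral_pos_part_le[OF assms])
  moreover have "\<bar>LINT x|neg_part_measure M \<nu>. f x\<bar> \<le> C * B"
    unfolding neg_part_measure_def using assms
    by (intro integral_pos_part_le) (auto simp: signed_measure_uminus tv_norm_uminus)
  ultimately show ?thesis
    unfolding signed_integral_def by linarith
qed

lemma signed_integral_diff:
  assumes \<nu>: "signed_measure M \<nu>" "tv_norm M \<nu> \<le> ennreal C" "0 \<le> C"
    and f: "f \<in> borel_measurable M" "\<And>x. x \<in> space M \<Longrightarrow> \<bar>f x\<bar> \<le> A" "0 \<le> A"
    and g: "g \<in> borel_measurable M" "\<And>x. x \<in> space M \<Longrightarrow> \<bar>g x\<bar> \<le> B" "0 \<le> B"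
  shows "signed_integral M \<nu> (\<lambda>x. f x - g x) = signed_integral M \<nu> f - signed_integral M \<nu> g"
proof -
  have \<nu>': "signed_measure M (\<lambda>A. - \<nu> A)" "tv_norm M (\<lambda>A. - \<nu> A) \<le> ennreal C"
    using \<nu> by (auto simp: signed_measure_uminus tv_norm_uminus)
  show ?thesis
    unfolding signed_integral_def neg_part_measure_def
    using integrable_pos_part[OF \<nu> f] integrable_pos_part[OF \<nu> g]
      integrable_pos_part[OF \<nu>' \<nu>(3) f] integrable_pos_part[OF \<nu>' \<nu>(3) g]
    by simp
qed

lemma signed_integral_cong:
  assumes "\<And>x. x \<in> space M \<Longrightarrow> f x = g x"
  shows "signed_integral M \<nu> f = signed_integral M \<nu> g"
proof -
  have "(LINT x|pos_part_measure M \<eta>. f x) = (LINT x|pos_part_measure M \<eta>. g x)" for \<eta>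
    using assms by (intro Bochner_Integration.integral_cong) simp_all
  then show ?thesis
    by (simp add: signed_integral_def neg_part_measure_def)
qed

lemma signed_integral_tendsto:
  assumes \<nu>: "signed_measure M \<nu>" "tv_norm M \<nu> \<le> ennreal C" "0 \<le> C"
    and f: "\<And>n. f n \<in> borel_measurable M" "\<And>n x. x \<in> space M \<Longrightarrow> \<bar>f n x\<bar> \<le> B" "0 \<le> B"
    and g: "g \<in> borel_measurable M" "\<And>x. x \<in> space M \<Longrightarrow> (\<lambda>n. f n x) \<longlonglongrightarrow> g x"
  shows "(\<lambda>n. signed_integral M \<nu> (f n)) \<longlonglongrightarrow> signed_integral M \<nu> g"
proof -
  have lim: "(\<lambda>n. LINT x|pos_part_measure M \<eta>. f n x) \<longlonglongrightarrow> (LINT x|pos_part_measure M \<eta>. g x)"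
    if \<eta>: "signed_measure M \<eta>" "tv_norm M \<eta> \<le> ennreal C" for \<eta>
  proof (rule integral_dominated_convergence)
    show "integrable (pos_part_measure M \<eta>) (\<lambda>x. B)"
      using f(3) by (intro integrable_pos_part[OF \<eta> \<nu>(3), of _ B]) simp_all
    show "g \<in> borel_measurable (pos_part_measure M \<eta>)"
      using g(1) by simp
    show "f n \<in> borel_measurable (pos_part_measure M \<eta>)" for n
      using f(1) by simp
    show "AE x in pos_part_measure M \<eta>. (\<lambda>n. f n x) \<longlonglongrightarrow> g x"
      using g(2) by (intro AE_I2) simp
    show "AE x in pos_part_measure M \<eta>. norm (f n x) \<le> B" for n
      using f(2) by (intro AE_I2) simp
  qed
  show ?thesis
    unfolding signed_integral_def neg_part_measure_def
    using \<nu> by (intro tendsto_diff lim) (simp_all add: signed_measure_uminus tv_norm_uminus)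
qed

section \<open>The right-hand side of the equation\<close>

definition delayed_integral ::
    "(real \<Rightarrow> real set \<Rightarrow> real) \<Rightarrow> (real \<Rightarrow> real) \<Rightarrow> real \<Rightarrow> real" where
  "delayed_integral \<mu> z \<tau> = signed_integral delay_space (\<mu> \<tau>) (\<lambda>s. z (\<tau> + s))"

lemma space_delay_space [simp]: "space delay_space = {-1..0}"
  by (simp add: space_restrict_space)

lemma coefficient_spaceD:
  assumes "\<mu> \<in> coefficient_space K T" "\<tau> \<in> {0..T}"
  shows "signed_measure delay_space (\<mu> \<tau>)" "tv_norm delay_space (\<mu> \<tau>) \<le> ennreal K"
  using assms by (auto simp: coefficient_space_def bounded_signed_measures_def)

lemma borel_measurable_segment:
  assumes "continuous_on {-1..T} z" "\<tau> \<in> {0..T}"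
  shows "(\<lambda>s. z (\<tau> + s)) \<in> borel_measurable delay_space"
  using assms
  by (intro borel_measurable_continuous_on_restrict continuous_on_compose2[OF assms(1)]
      continuous_intros) auto

lemma continuous_on_interval_bounded:
  fixes z :: "real \<Rightarrow> real"
  assumes "continuous_on {a..b} z"
  obtains B where "0 \<le> B" "\<And>t. t \<in> {a..b} \<Longrightarrow> \<bar>z t\<bar> \<le> B"
proof -
  have "bounded (z ` {a..b})"
    using assms by (intro compact_imp_bounded compact_continuous_image) auto
  then obtain B where "0 < B" "\<And>t. t \<in> {a..b} \<Longrightarrow> \<bar>z t\<bar> \<le> B"
    unfolding bounded_pos by auto
  then show ?thesis by (intro that[of B]) auto
qed

lemma delayed_integral_cong:
  assumes "\<And>t. t \<in> {-1..T} \<Longrightarrow> z t = w t" "\<tau> \<in> {0..T}"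
  shows "delayed_integral \<mu> z \<tau> = delayed_integral \<mu> w \<tau>"
  unfolding delayed_integral_def using assms by (intro signed_integral_cong) auto

lemma delayed_integral_bound:
  assumes "\<mu> \<in> coefficient_space K T" "0 \<le> K" "continuous_on {-1..T} z" "\<tau> \<in> {0..T}"
    and "\<And>s. s \<in> {-1..0} \<Longrightarrow> \<bar>z (\<tau> + s)\<bar> \<le> B"
  shows "\<bar>delayed_integral \<mu> z \<tau>\<bar> \<le> 2 * K * B"
  unfolding delayed_integral_def using assms assms(5)[of 0]
  by (intro signed_integral_bound coefficient_spaceD borel_measurable_segment) auto

lemma delayed_integral_diff:
  assumes \<mu>: "\<mu> \<in> coefficient_space K T" "0 \<le> K"
    and z: "continuous_on {-1..T} z" and w: "continuous_on {-1..T} w" and "\<tau> \<in> {0..T}"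
  shows "delayed_integral \<mu> (\<lambda>t. z t - w t) \<tau> = delayed_integral \<mu> z \<tau> - delayed_integral \<mu> w \<tau>"
proof -
  obtain A where A: "0 \<le> A" "\<And>t. t \<in> {-1..T} \<Longrightarrow> \<bar>z t\<bar> \<le> A"
    using continuous_on_interval_bounded[OF z] by blast
  obtain B where B: "0 \<le> B" "\<And>t. t \<in> {-1..T} \<Longrightarrow> \<bar>w t\<bar> \<le> B"
    using continuous_on_interval_bounded[OF w] by blast
  show ?thesis
    unfolding delayed_integral_def using assms A B
    by (intro signed_integral_diff[where C=K and A=A and B=B] coefficient_spaceD
        borel_measurable_segment) auto
qed

text \<open>
  For \<open>\<tau>\<close> in a grid cell the translation is frozen at the left end of the cell. The frozen function is
  measurable in \<open>\<tau>\<close>, being assembled from countably many functions to which weak-* measurability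
  applies, and it converges to the right-hand side at every \<open>\<tau>\<close> as the mesh tends to zero.
\<close>

lemma borel_measurable_delayed_integral:
  assumes \<mu>: "\<mu> \<in> coefficient_space K T" "0 \<le> K" and "0 < T"
    and z: "continuous_on {-1..T} z"
  shows "delayed_integral \<mu> z \<in> borel_measurable (lebesgue_on {0..T})"
proof -
  obtain B where B: "0 \<le> B" "\<And>t. t \<in> {-1..T} \<Longrightarrow> \<bar>z t\<bar> \<le> B"
    using continuous_on_interval_bounded[OF z] by blast
  \<comment> \<open>Grid points are truncated to \<open>[0, T]\<close> so that \<open>z\<close>, shifted by any of them, is continuous on the
    history interval; \<open>q\<close> selects the cell of \<open>\<tau>\<close>.\<close>
  define p where "p n i = max 0 (min T (of_int i / real (Suc n)))" for n i
  define q where "q n \<tau> = \<lfloor>real (Suc n) * \<tau>\<rfloor>" for n and \<tau> :: real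
  have p: "p n i \<in> {0..T}" for n i
    using \<open>0 < T\<close> by (auto simp: p_def)
  have q_tendsto: "(\<lambda>n. p n (q n \<tau>)) \<longlonglongrightarrow> \<tau>" if "\<tau> \<in> {0..T}" for \<tau>
  proof -
    have "(\<lambda>n. of_int (q n \<tau>) / real (Suc n)) \<longlonglongrightarrow> \<tau>"
    proof (rule tendsto_sandwich)
      have q: "of_int (q n \<tau>) \<le> real (Suc n) * \<tau>" "real (Suc n) * \<tau> - 1 \<le> of_int (q n \<tau>)" for n
        unfolding q_def by linarith+
      have "\<tau> - 1 / real (Suc n) \<le> of_int (q n \<tau>) / real (Suc n)" for n
      proof -
        have "\<tau> - 1 / real (Suc n) = (real (Suc n) * \<tau> - 1) / real (Suc n)"
          by (simp add: diff_divide_distrib)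
        then show ?thesis using q(2)[of n] by (simp add: divide_right_mono)
      qed
      then show "\<forall>\<^sub>F n in sequentially. \<tau> - 1 / real (Suc n) \<le> of_int (q n \<tau>) / real (Suc n)"
        by simp
      show "\<forall>\<^sub>F n in sequentially. of_int (q n \<tau>) / real (Suc n) \<le> \<tau>"
        using q(1) by (intro always_eventually allI) (simp add: field_simps)
      show "(\<lambda>n. \<tau> - 1 / real (Suc n)) \<longlonglongrightarrow> \<tau>"
        using tendsto_diff[OF tendsto_const[of \<tau>] LIMSEQ_inverse_real_of_nat]
        by (simp add: inverse_eq_divide)
    qed auto
    then have "(\<lambda>n. p n (q n \<tau>)) \<longlonglongrightarrow> max 0 (min T \<tau>)"
      unfolding p_def by (intro tendsto_max tendsto_min tendsto_const)
    then show ?thesis using that by simp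
  qed
  show ?thesis
  proof (rule borel_measurable_LIMSEQ_real)
    fix n :: nat
    show "(\<lambda>\<tau>. signed_integral delay_space (\<mu> \<tau>) (\<lambda>s. z (p n (q n \<tau>) + s)))
      \<in> borel_measurable (lebesgue_on {0..T})"
    proof (rule measurable_compose_countable[where g="q n"])
      fix i
      have "continuous_on {-1..0} (\<lambda>s. z (p n i + s))"
        using p[of n i] by (intro continuous_on_compose2[OF z] continuous_intros) auto
      then show "(\<lambda>\<tau>. signed_integral delay_space (\<mu> \<tau>) (\<lambda>s. z (p n i + s)))
        \<in> borel_measurable (lebesgue_on {0..T})"
        using \<mu> by (auto simp: coefficient_space_def)
    next
      have "q n \<in> measurable borel (count_space UNIV)"
        unfolding q_def by measurable
      then show "q n \<in> measurable (lebesgue_on {0..T}) (count_space UNIV)"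
        by (intro measurable_restrict_space1 measurable_completion) simp
    qed
  next
    fix \<tau> assume "\<tau> \<in> space (lebesgue_on {0..T})"
    then have \<tau>: "\<tau> \<in> {0..T}" by (simp add: space_restrict_space)
    show "(\<lambda>n. signed_integral delay_space (\<mu> \<tau>) (\<lambda>s. z (p n (q n \<tau>) + s)))
      \<longlonglongrightarrow> delayed_integral \<mu> z \<tau>"
      unfolding delayed_integral_def
    proof (rule signed_integral_tendsto)
      show "signed_measure delay_space (\<mu> \<tau>)" "tv_norm delay_space (\<mu> \<tau>) \<le> ennreal K"
        by (rule coefficient_spaceD[OF \<mu>(1) \<tau>])+
      show "(\<lambda>s. z (p n (q n \<tau>) + s)) \<in> borel_measurable delay_space" for n
        by (rule borel_measurable_segment[OF z p])
      show "(\<lambda>s. z (\<tau> + s)) \<in> borel_measurable delay_space"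
        by (rule borel_measurable_segment[OF z \<tau>])
      show "\<bar>z (p n (q n \<tau>) + s)\<bar> \<le> B" if "s \<in> space delay_space" for n s
        using p[of n "q n \<tau>"] that by (intro B) auto
      show "(\<lambda>n. z (p n (q n \<tau>) + s)) \<longlonglongrightarrow> z (\<tau> + s)" if s: "s \<in> space delay_space" for s
      proof (rule continuous_on_tendsto_compose[OF z])
        show "(\<lambda>n. p n (q n \<tau>) + s) \<longlonglongrightarrow> \<tau> + s"
          by (intro tendsto_add q_tendsto \<tau> tendsto_const)
        show "\<tau> + s \<in> {-1..T}" using \<tau> s by auto
        show "\<forall>\<^sub>F n in sequentially. p n (q n \<tau>) + s \<in> {-1..T}"
        proof (intro always_eventually allI)
          show "p n (q n \<tau>) + s \<in> {-1..T}" for n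
            using p[of n "q n \<tau>"] s by auto
        qed
      qed
    qed (use \<mu> B in auto)
  qed
qed

lemma set_integrable_delayed_integral:
  assumes \<mu>: "\<mu> \<in> coefficient_space K T" "0 \<le> K" and "0 < T"
    and z: "continuous_on {-1..T} z"
  shows "set_integrable lebesgue {0..T} (delayed_integral \<mu> z)"
proof -
  obtain B where B: "0 \<le> B" "\<And>t. t \<in> {-1..T} \<Longrightarrow> \<bar>z t\<bar> \<le> B"
    using continuous_on_interval_bounded[OF z] by blast
  interpret finite_measure "lebesgue_on {0..T}"
    by (rule finite_measure_lebesgue_on) auto
  have "\<bar>delayed_integral \<mu> z \<tau>\<bar> \<le> 2 * K * B" if "\<tau> \<in> {0..T}" for \<tau>
    using that by (intro delayed_integral_bound[OF \<mu> z] B) auto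
  then have "integrable (lebesgue_on {0..T}) (delayed_integral \<mu> z)"
    using borel_measurable_delayed_integral[OF assms]
    by (intro integrable_const_bound[where B="2 * K * B"]) (auto simp: space_restrict_space)
  then show ?thesis
    by (simp add: set_integrable_def integrable_restrict_space)
qed

section \<open>The Picard operator\<close>

text \<open>
  One formula serves both intervals: for \<open>t < 0\<close> the domain of integration is empty, and for \<open>t > 0\<close>
  the minimum stops the history at \<open>u0 0\<close>.
\<close>

definition picard ::
    "(real \<Rightarrow> real set \<Rightarrow> real) \<Rightarrow> (real \<Rightarrow> real) \<Rightarrow> (real \<Rightarrow> real) \<Rightarrow> real \<Rightarrow> real" where
  "picard \<mu> u0 z t = u0 (min t 0) + (LINT \<tau>:{0..t}|lebesgue. delayed_integral \<mu> z \<tau>)"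

lemma set_integral_atLeastAtMost_nonpos:
  fixes f :: "real \<Rightarrow> real"
  assumes "t \<le> 0"
  shows "(LINT \<tau>:{0..t}|lebesgue. f \<tau>) = 0"
proof -
  have "{0..t} \<in> null_sets lebesgue"
    using assms by (cases "t = 0") auto
  then have "AE \<tau> in lebesgue. indicator {0..t} \<tau> *\<^sub>R f \<tau> = 0"
    by (rule AE_I') (auto simp: indicator_def)
  then show ?thesis
    unfolding set_lebesgue_integral_def by (rule integral_eq_zero_AE)
qed

lemma picard_eq_initial:
  assumes "t \<le> 0"
  shows "picard \<mu> u0 z t = u0 t"
  using assms by (simp add: picard_def set_integral_atLeastAtMost_nonpos)

lemma picard_cong:
  assumes "\<And>t. t \<in> {-1..T} \<Longrightarrow> z t = w t" "t \<le> T"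
  shows "picard \<mu> u0 z t = picard \<mu> u0 w t"
proof -
  have "(LINT \<tau>:{0..t}|lebesgue. delayed_integral \<mu> z \<tau>)
    = (LINT \<tau>:{0..t}|lebesgue. delayed_integral \<mu> w \<tau>)"
    using assms by (intro set_lebesgue_integral_cong) (auto intro!: delayed_integral_cong[of T])
  then show ?thesis by (simp add: picard_def)
qed

text \<open>
  The integral from 0 to \<open>t\<close> is an indefinite integral in the variable \<open>max t 0\<close>, hence continuous
  across \<open>t = 0\<close> as well.
\<close>

lemma continuous_on_picard:
  assumes \<mu>: "\<mu> \<in> coefficient_space K T" "0 \<le> K" and "0 < T"
    and u0: "continuous_on {-1..0} u0" and z: "continuous_on {-1..T} z"
  shows "continuous_on {-1..T} (picard \<mu> u0 z)"
proof -
  let ?F = "delayed_integral \<mu> z"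
  have int: "set_integrable lebesgue {0..T} ?F"
    by (rule set_integrable_delayed_integral[OF \<mu> \<open>0 < T\<close> z])
  have eq: "(LINT \<tau>:{0..t}|lebesgue. ?F \<tau>) = integral {0..max t 0} ?F" if "t \<in> {-1..T}" for t
  proof (cases "0 \<le> t")
    case True
    then have "set_integrable lebesgue {0..t} ?F"
      using that by (intro set_integrable_subset[OF int]) auto
    then show ?thesis
      using True by (simp add: set_lebesgue_integral_eq_integral max_absorb1)
  next
    case False
    then show ?thesis
      using set_integral_atLeastAtMost_nonpos[of t ?F] by simp
  qed
  have "continuous_on {0..T} (\<lambda>t. integral {0..t} ?F)"
    using set_lebesgue_integral_eq_integral(1)[OF int] by (rule indefinite_integral_continuous_1)
  then have "continuous_on {-1..T} (\<lambda>t. integral {0..max t 0} ?F)"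
    by (rule continuous_on_compose2) (use \<open>0 < T\<close> in \<open>auto intro!: continuous_intros\<close>)
  moreover have "continuous_on {-1..T} (\<lambda>t. u0 (min t 0))"
    using u0 by (rule continuous_on_compose2) (auto intro!: continuous_intros)
  ultimately have "continuous_on {-1..T} (\<lambda>t. u0 (min t 0) + integral {0..max t 0} ?F)"
    by (rule continuous_on_add[rotated])
  then show ?thesis
    by (rule continuous_on_eq) (simp add: picard_def eq)
qed

text \<open>
  The right-hand side along a continuous function is measurable and bounded, which yields the
  integrability clause; the two prescriptions for \<open>z\<close> agree at \<open>t = 0\<close> and merge into one equation.
\<close>

lemma caratheodory_solution_iff:
  assumes \<mu>: "\<mu> \<in> coefficient_space K T" "0 \<le> K" and "0 < T"
  shows "caratheodory_solution T \<mu> u0 z \<longleftrightarrow>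
    z \<in> extensional {-1..T} \<and> continuous_on {-1..T} z \<and> (\<forall>t\<in>{-1..T}. z t = picard \<mu> u0 z t)"
proof -
  have split: "{-1..T} = {-1..0} \<union> {0..T}" using \<open>0 < T\<close> by auto
  have "picard \<mu> u0 z t = u0 0 + (LINT \<tau>:{0..t}|lebesgue. delayed_integral \<mu> z \<tau>)"
    if "t \<in> {0..T}" for t
    using that by (simp add: picard_def min_absorb2)
  moreover have "picard \<mu> u0 z t = u0 t" if "t \<in> {-1..0}" for t
    using that by (simp add: picard_eq_initial)
  ultimately have eq: "(\<forall>t\<in>{-1..T}. z t = picard \<mu> u0 z t) \<longleftrightarrow> (\<forall>t\<in>{-1..0}. z t = u0 t) \<and>
    (\<forall>t\<in>{0..T}. z t = u0 0 + (LINT \<tau>:{0..t}|lebesgue. delayed_integral \<mu> z \<tau>))"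
    unfolding split ball_Un by (metis (no_types, lifting))
  show ?thesis
    unfolding eq caratheodory_solution_def
    using set_integrable_delayed_integral[OF assms, of z]
    unfolding delayed_integral_def[abs_def] by blast
qed

text \<open>
  The factor 1/2 arises because the weight grows at twice the rate \<open>2 * K\<close> at which the right-hand
  side can amplify differences: \<open>\<integral> 2 * K * exp (4 * K * \<tau>) d\<tau> = exp (4 * K * \<tau>) / 2\<close>.
\<close>

lemma picard_diff_bound:
  assumes \<mu>: "\<mu> \<in> coefficient_space K T" and "0 < K" and "0 < T"
    and z: "continuous_on {-1..T} z" and w: "continuous_on {-1..T} w"
    and D: "0 \<le> D" "\<And>t. t \<in> {-1..T} \<Longrightarrow> \<bar>z t - w t\<bar> \<le> D * exp (4 * K * t)"
    and t: "t \<in> {-1..T}"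
  shows "\<bar>picard \<mu> u0 z t - picard \<mu> u0 w t\<bar> \<le> D / 2 * exp (4 * K * t)"
proof (cases "0 \<le> t")
  case False
  then show ?thesis using D by (simp add: picard_eq_initial)
next
  case True
  let ?H = "\<lambda>\<tau>. delayed_integral \<mu> z \<tau> - delayed_integral \<mu> w \<tau>"
  have K: "0 \<le> K" using \<open>0 < K\<close> by simp
  have int: "set_integrable lebesgue {0..t} (delayed_integral \<mu> v)"
    if "continuous_on {-1..T} v" for v
    using t by (intro set_integrable_subset[OF set_integrable_delayed_integral[OF \<mu> K \<open>0 < T\<close> that]])
      auto
  have bound: "norm (?H \<tau>) \<le> 2 * K * (D * exp (4 * K * \<tau>))" if \<tau>: "\<tau> \<in> {0..t}" for \<tau>
  proof -
    have \<tau>': "\<tau> \<in> {0..T}" using \<tau> t by auto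
    have "\<bar>z (\<tau> + s) - w (\<tau> + s)\<bar> \<le> D * exp (4 * K * \<tau>)" if "s \<in> {-1..0}" for s
    proof -
      have "\<bar>z (\<tau> + s) - w (\<tau> + s)\<bar> \<le> D * exp (4 * K * (\<tau> + s))"
        using \<tau>' that by (intro D) auto
      \<comment> \<open>Delays look back only: \<open>s \<le> 0\<close>, and the weight increases.\<close>
      also have "\<dots> \<le> D * exp (4 * K * \<tau>)"
        using that \<open>0 < K\<close> D by (intro mult_left_mono) auto
      finally show ?thesis .
    qed
    then have "\<bar>delayed_integral \<mu> (\<lambda>t. z t - w t) \<tau>\<bar> \<le> 2 * K * (D * exp (4 * K * \<tau>))"
      by (intro delayed_integral_bound[OF \<mu> K _ \<tau>'] continuous_intros z w)
    then show ?thesis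
      by (simp add: delayed_integral_diff[OF \<mu> K z w \<tau>'])
  qed
  have "((\<lambda>\<tau>. 2 * K * (D * exp (4 * K * \<tau>))) has_integral
    (D / 2 * exp (4 * K * t) - D / 2 * exp (4 * K * 0))) {0..t}"
    using True by (intro fundamental_theorem_of_calculus)
      (auto intro!: derivative_eq_intros simp flip: has_real_derivative_iff_has_vector_derivative)
  then have G: "(\<lambda>\<tau>. 2 * K * (D * exp (4 * K * \<tau>))) integrable_on {0..t}"
    "integral {0..t} (\<lambda>\<tau>. 2 * K * (D * exp (4 * K * \<tau>))) = D / 2 * exp (4 * K * t) - D / 2"
    by (auto simp: has_integral_iff)
  have H: "set_integrable lebesgue {0..t} ?H"
    by (intro set_integral_diff int z w)
  have "picard \<mu> u0 z t - picard \<mu> u0 w t = (LINT \<tau>:{0..t}|lebesgue. ?H \<tau>)"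
    by (simp add: picard_def set_integral_diff int z w)
  also have "\<dots> = integral {0..t} ?H"
    by (rule set_lebesgue_integral_eq_integral(2)[OF H])
  also have "norm \<dots> \<le> integral {0..t} (\<lambda>\<tau>. 2 * K * (D * exp (4 * K * \<tau>)))"
    using set_lebesgue_integral_eq_integral(1)[OF H] G(1) bound by (rule integral_norm_bound_integral)
  finally show ?thesis using G(2) D by simp
qed

section \<open>Existence and uniqueness\<close>

theorem proposition3p1:
  fixes T K :: real and \<mu> :: "real \<Rightarrow> real set \<Rightarrow> real" and u0 :: "real \<Rightarrow> real"
  assumes "T > 0" and "K > 0"
    and "\<mu> \<in> coefficient_space K T"
    and "continuous_on {-1..0} u0"
  shows "\<exists>!z. caratheodory_solution T \<mu> u0 z"
proof -
  have K: "0 \<le> K" using \<open>K > 0\<close> by simp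
  note solution_iff = caratheodory_solution_iff[OF assms(3) K \<open>T > 0\<close>, of u0]
  \<comment> \<open>An unknown \<open>z\<close> is encoded as the quotient \<open>z / e\<close>, whose uniform distances are the weighted
    distances of the unknowns. Extending the quotient constantly outside \<open>[-1, T]\<close>, by \<^const>\<open>clamp\<close>,
    places it in the complete space of bounded continuous functions on the line; \<open>W\<close> decodes.\<close>
  define e where "e t = exp (4 * K * t)" for t
  have e: "e t > 0" for t by (simp add: e_def)
  have e_cont: "continuous_on A e" for A unfolding e_def by (intro continuous_intros)
  define W where "W g t = e t * apply_bcontfun g t" for g t
  have W_cont: "continuous_on {-1..T} (W g)" for g
    unfolding W_def by (intro continuous_on_mult e_cont continuous_on_apply_bcontfun)

  have ex_ext: "\<exists>g. \<forall>t. apply_bcontfun g t = v (clamp (-1) T t) / e (clamp (-1) T t)"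
    if "continuous_on {-1..T} v" for v
  proof -
    have "continuous_on (cbox (-1) T) (\<lambda>t. v t / e t)"
      using that by (intro continuous_on_divide e_cont) (auto simp: e_def)
    then show ?thesis
    proof (rule continuous_on_cbox_bcontfunE)
      fix g assume "\<And>t. apply_bcontfun g t = v (clamp (-1) T t) / e (clamp (-1) T t)"
      then show ?thesis by (intro exI[of _ g] allI)
    qed
  qed
  \<comment> \<open>\<open>\<Phi>\<close> is the Picard operator on encoded unknowns.\<close>
  define \<Phi> where "\<Phi> g = (SOME h. \<forall>t. apply_bcontfun h t
    = picard \<mu> u0 (W g) (clamp (-1) T t) / e (clamp (-1) T t))" for g
  have \<Phi>: "apply_bcontfun (\<Phi> g) t
    = picard \<mu> u0 (W g) (clamp (-1) T t) / e (clamp (-1) T t)" for g t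
    using someI_ex[OF ex_ext[OF continuous_on_picard[OF assms(3) K \<open>T > 0\<close> assms(4) W_cont[of g]]]]
    unfolding \<Phi>_def by (rule spec)
  have clamp: "clamp (-1) T t \<in> {-1..T}" for t
    using clamp_in_interval[of "-1" T t] \<open>T > 0\<close> by simp
  have clamp_id: "clamp (-1) T t = t" if "t \<in> {-1..T}" for t
    using that by simp

  have "dist (\<Phi> g) (\<Phi> h) \<le> 1/2 * dist g h" for g h
  proof (rule dist_bound)
    fix t
    let ?c = "clamp (-1) T t"
    have "\<bar>W g s - W h s\<bar> \<le> dist g h * e s" for s
    proof -
      have "\<bar>W g s - W h s\<bar> = dist (g s) (h s) * e s"
        using e[of s] by (simp add: W_def dist_real_def abs_mult flip: right_diff_distrib)
      then show ?thesis
        using dist_bounded[of g s h] e[of s] by (simp add: mult_right_mono)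
    qed
    then have "\<bar>picard \<mu> u0 (W g) ?c - picard \<mu> u0 (W h) ?c\<bar> \<le> dist g h / 2 * e ?c"
      unfolding e_def
      by (intro picard_diff_bound[OF assms(3,2,1) W_cont W_cont _ _ clamp]) auto
    moreover have "dist (\<Phi> g t) (\<Phi> h t) =
      \<bar>picard \<mu> u0 (W g) ?c - picard \<mu> u0 (W h) ?c\<bar> / e ?c"
      using e[of ?c] unfolding \<Phi> dist_real_def by (simp flip: diff_divide_distrib)
    ultimately show "dist (\<Phi> g t) (\<Phi> h t) \<le> 1/2 * dist g h"
      using e[of ?c] by (simp add: pos_divide_le_eq)
  qed
  then have "\<exists>!g. \<Phi> g = g"
    by (intro banach_fix_type[of "1/2"]) auto
  then obtain g where g: "\<Phi> g = g" and g_unique: "\<And>h. \<Phi> h = h \<Longrightarrow> h = g" by blast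

  show ?thesis
  proof (rule ex1I)
    define z where "z = restrict (W g) {-1..T}"
    have "W g t = picard \<mu> u0 (W g) t" if "t \<in> {-1..T}" for t
      using \<Phi>[of g t] that e[of t] by (simp add: g W_def clamp_id)
    moreover have "picard \<mu> u0 z t = picard \<mu> u0 (W g) t" if "t \<in> {-1..T}" for t
      using that by (intro picard_cong[of T]) (auto simp: z_def)
    moreover have "continuous_on {-1..T} z"
      using W_cont by (rule continuous_on_eq) (simp add: z_def)
    moreover have "z t = W g t" if "t \<in> {-1..T}" for t
      using that by (simp add: z_def)
    moreover have "z \<in> extensional {-1..T}"
      by (simp add: z_def)
    ultimately show "caratheodory_solution T \<mu> u0 z"
      unfolding solution_iff by metis
  next
    fix y assume "caratheodory_solution T \<mu> u0 y"
    then have y: "y \<in> extensional {-1..T}" "continuous_on {-1..T} y"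
      "\<And>t. t \<in> {-1..T} \<Longrightarrow> y t = picard \<mu> u0 y t"
      by (auto simp: solution_iff)
    from ex_ext[OF y(2)] obtain h
      where h: "\<And>t. apply_bcontfun h t = y (clamp (-1) T t) / e (clamp (-1) T t)" by blast
    \<comment> \<open>The code \<open>h\<close> of any solution \<open>y\<close> is a fixed point of \<open>\<Phi>\<close>, hence equals \<open>g\<close>.\<close>
    have Wh: "W h t = y t" if "t \<in> {-1..T}" for t
      using e[of t] that by (simp add: W_def h clamp_id)
    have "\<Phi> h t = h t" for t
      using picard_cong[of T "W h" y "clamp (-1) T t" \<mu> u0] Wh clamp[of t] y(3)[OF clamp[of t]]
      by (simp add: \<Phi> h)
    then have "h = g"
      by (rule g_unique[OF bcontfun_eqI])
    then show "y = restrict (W g) {-1..T}"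
      using Wh y(1) by (auto intro!: extensionalityI[of _ "{-1..T}"])
  qed
qed

end
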